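(* For every complete signed graph $G$, $\mathrm{OPT}_{CC}(G)\le \tfrac{3}{2}\,\mathrm{OPT}_{\Delta}(G)$.
   Context: A complete signed graph is $G=(V,E^+,E^-)$ where every pair of distinct vertices belongs to exactly one of $E^+$ (positive edges) or $E^-$ (negative edges). A bad triangle is a triple of vertices whose three pairs contain exactly one negative edge. A bad triangle cover is a set of pairs containing at least one pair of every bad triangle; $\mathrm{OPT}_{\Delta}(G)$ is the minimum size of a bad triangle cover. For a partition (clustering) of $V$, its number of disagreements (mistakes) is the number of positive edges whose endpoints lie in different parts plus the number of negative edges whose endpoints lie in the same part; $\mathrm{OPT}_{CC}(G)$ is the minimum number of disagreements over all partitions of $V$ (correlation clustering optimum). *)

theory Defs
  imports Complex_Main "HOL-Library.Disjoint_Sets"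
begin

definition pairs :: "'a set \<Rightarrow> 'a set set" where
  "pairs V = {e. e \<subseteq> V \<and> card e = 2}"

definition complete_signed_graph :: "'a set \<Rightarrow> 'a set set \<Rightarrow> 'a set set \<Rightarrow> bool" where
  "complete_signed_graph V Ep En \<longleftrightarrow>
     finite V \<and> Ep \<union> En = pairs V \<and> Ep \<inter> En = {}"

definition bad_triangle :: "'a set \<Rightarrow> 'a set set \<Rightarrow> 'a set set \<Rightarrow> 'a set \<Rightarrow> bool" where
  "bad_triangle V Ep En T \<longleftrightarrow>
     T \<subseteq> V \<and> card T = 3 \<and> card (pairs T \<inter> En) = 1"

definition bad_triangle_cover :: "'a set \<Rightarrow> 'a set set \<Rightarrow> 'a set set \<Rightarrow> 'a set set \<Rightarrow> bool" where
  "bad_triangle_cover V Ep En C \<longleftrightarrow>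
     C \<subseteq> pairs V \<and> (\<forall>T. bad_triangle V Ep En T \<longrightarrow> pairs T \<inter> C \<noteq> {})"

definition OPT_Delta :: "'a set \<Rightarrow> 'a set set \<Rightarrow> 'a set set \<Rightarrow> nat" where
  "OPT_Delta V Ep En = Min {card C | C. bad_triangle_cover V Ep En C}"

definition disagreements :: "'a set set \<Rightarrow> 'a set set \<Rightarrow> 'a set set \<Rightarrow> nat" where
  "disagreements Ep En P =
     card {e \<in> Ep. \<exists>A\<in>P. \<exists>B\<in>P. A \<noteq> B \<and> e \<inter> A \<noteq> {} \<and> e \<inter> B \<noteq> {}} +
     card {e \<in> En. \<exists>A\<in>P. e \<subseteq> A}"

definition OPT_CC :: "'a set \<Rightarrow> 'a set set \<Rightarrow> 'a set set \<Rightarrow> nat" where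
  "OPT_CC V Ep En = Min {disagreements Ep En P | P. partition_on V P}"

text \<open>Both minima range over finite nonempty sets, so \<^const>\<open>Min\<close> is meaningful.\<close>

lemma OPT_Delta_set:
  assumes "complete_signed_graph V Ep En"
  shows "finite {card C | C. bad_triangle_cover V Ep En C}"
    and "{card C | C. bad_triangle_cover V Ep En C} \<noteq> {}"
proof -
  have "finite (pairs V)"
    using assms by (auto simp: complete_signed_graph_def pairs_def)
  then have "finite {C. bad_triangle_cover V Ep En C}"
    by (rule finite_subset[rotated, OF finite_Pow_iff[THEN iffD2]])
      (auto simp: bad_triangle_cover_def)
  then show "finite {card C | C. bad_triangle_cover V Ep En C}"
    by simp
  have "pairs T \<inter> pairs V \<noteq> {}" if "bad_triangle V Ep En T" for T
  proof -
    have "pairs T \<inter> En \<noteq> {}" "T \<subseteq> V"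
      using that by (auto simp: bad_triangle_def)
    then show ?thesis by (auto simp: pairs_def)
  qed
  then have "bad_triangle_cover V Ep En (pairs V)"
    by (simp add: bad_triangle_cover_def)
  then show "{card C | C. bad_triangle_cover V Ep En C} \<noteq> {}"
    by blast
qed

lemma OPT_CC_set:
  assumes "complete_signed_graph V Ep En"
  shows "finite {disagreements Ep En P | P. partition_on V P}"
    and "{disagreements Ep En P | P. partition_on V P} \<noteq> {}"
proof -
  have "finite (Pow (Pow V))"
    using assms by (simp add: complete_signed_graph_def)
  then have "finite {P. partition_on V P}"
    by (rule finite_subset[rotated]) (auto simp: partition_on_def)
  then show "finite {disagreements Ep En P | P. partition_on V P}"
    by simp
  have "partition_on V ((\<lambda>v. {v}) ` V)"
    by (rule partition_onI) (auto simp: disjnt_def)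
  then show "{disagreements Ep En P | P. partition_on V P} \<noteq> {}"
    by blast
qed

end

theory Submission
  imports Defs
begin

text \<open>
  Given a bad triangle cover \<open>C\<close>, run a randomised pivot algorithm: pick a pivot \<open>u\<close> uniformly,
  put \<open>u\<close> and, independently, every other vertex \<open>v\<close> with probability \<open>p u v\<close> into one cluster,
  remove the cluster, and recurse. Here \<open>p u v\<close> is 1 or 0 for uncovered positive or negative pairs,
  and 1/4 or 3/4 for covered positive or negative pairs. Charging the mistakes of a round against
  3/2 for every covered pair that leaves the graph, the expected balance of a round is a sum over
  triples of vertices, and it is nonpositive on each of them. (The triangles
  in which exactly one pair is covered force the values 1/4 and 3/4.) The algorithm is derandomised:
  the balance of a round is affine in each probability, so rounding them one by one to 0 or 1
  need not increase it.
\<close>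

section \<open>Expected balance on a triple of vertices\<close>

definition join_prob :: "bool \<Rightarrow> bool \<Rightarrow> real" where
  "join_prob n c = (if c then if n then 3/4 else 1/4 else if n then 0 else 1)"

text \<open>
  The expected balance of a pair with sign \<open>n\<close> (true if negative) and covering status \<open>c\<close> whose
  endpoints join the cluster independently with probabilities \<open>p\<close> and \<open>q\<close>.
\<close>

definition balance :: "bool \<Rightarrow> bool \<Rightarrow> real \<Rightarrow> real \<Rightarrow> real" where
  "balance n c p q = (if n then p * q else p + q - 2 * p * q) - (if c then 3/2 * (p + q - p * q) else 0)"

text \<open>Each vertex of the triple is the pivot once and decides the fate of the opposite pair,
  whose ends join with the probabilities attached to the other two pairs. The hypotheses exclude
  exactly the uncovered bad triangles, and what remains is a finite check. It is tight: a bad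
  triangle with only its negative pair covered gives -1/2 + 1/4 + 1/4.\<close>

lemma balance_triangle_le_0:
  assumes "n1 \<Longrightarrow> \<not> n2 \<Longrightarrow> \<not> n3 \<Longrightarrow> c1 \<or> c2 \<or> c3"
    and "n2 \<Longrightarrow> \<not> n1 \<Longrightarrow> \<not> n3 \<Longrightarrow> c1 \<or> c2 \<or> c3"
    and "n3 \<Longrightarrow> \<not> n1 \<Longrightarrow> \<not> n2 \<Longrightarrow> c1 \<or> c2 \<or> c3"
  shows "balance n1 c1 (join_prob n2 c2) (join_prob n3 c3)
       + balance n2 c2 (join_prob n3 c3) (join_prob n1 c1)
       + balance n3 c3 (join_prob n1 c1) (join_prob n2 c2) \<le> 0"
  using assms
  by (cases n1; cases n2; cases n3; cases c1; cases c2; cases c3)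
    (simp_all add: balance_def join_prob_def)

text \<open>Treats the pairs at the pivot, which joins with probability 1: an uncovered pair causes
  no mistake there, and a covered one costs 3/4 in expectation against a charge of 3/2.\<close>

lemma balance_pivot_le_0: "balance n c 1 (join_prob n c) \<le> 0"
  by (simp add: balance_def join_prob_def)

lemma balance_commute: "balance n c p q = balance n c q p"
  by (simp add: balance_def algebra_simps)

lemma balance_affine:
  "balance n c t q = (1 - t) * balance n c 0 q + t * balance n c 1 q"
  by (simp add: balance_def field_simps)

section \<open>Derandomisation\<close>

text \<open>Method of conditional expectations: along one coordinate, the value of \<open>f\<close>
  is a weighted average of its values at 0 and 1, so one of these is no larger.\<close>

lemma exists_rounding_le:
  fixes f :: "('a \<Rightarrow> real) \<Rightarrow> real"
  assumes "finite W"
    and affine: "\<And>x v t. f (x(v := t)) = (1 - t) * f (x(v := 0)) + t * f (x(v := 1))"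
    and "\<And>v. v \<in> W \<Longrightarrow> 0 \<le> x v \<and> x v \<le> 1"
  shows "\<exists>y. (\<forall>v\<in>W. y v = 0 \<or> y v = 1) \<and> (\<forall>v. v \<notin> W \<longrightarrow> y v = x v) \<and> f y \<le> f x"
  using assms(1,3)
proof (induction W)
  case empty
  then show ?case by auto
next
  case (insert a W)
  then obtain y where y: "\<forall>v\<in>W. y v = 0 \<or> y v = 1" "\<forall>v. v \<notin> W \<longrightarrow> y v = x v" "f y \<le> f x"
    by (metis insertCI)
  let ?m = "min (f (y(a := 0))) (f (y(a := 1)))"
  have t: "0 \<le> y a" "y a \<le> 1"
    using y(2) insert.hyps insert.prems by auto
  have "?m = (1 - y a) * ?m + y a * ?m"
    by (simp add: algebra_simps)
  also have "\<dots> \<le> (1 - y a) * f (y(a := 0)) + y a * f (y(a := 1))"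
    using t by (intro add_mono mult_left_mono) auto
  also have "\<dots> = f y"
    using affine[of y a "y a"] by simp
  finally obtain b where b: "b = 0 \<or> b = 1" "f (y(a := b)) \<le> f y"
    by (metis min_le_iff_disj)
  have "f (y(a := b)) \<le> f x"
    using b(2) y(3) by (rule order_trans)
  moreover have "\<forall>v\<in>insert a W. (y(a := b)) v = 0 \<or> (y(a := b)) v = 1"
    "\<forall>v. v \<notin> insert a W \<longrightarrow> (y(a := b)) v = x v"
    using b(1) y(1,2) by auto
  ultimately show ?case
    by blast
qed

section \<open>Pivot rounds and their iteration\<close>

text \<open>At values 0 and 1, \<open>balance\<close> is the actual outcome of a round with cluster
  \<open>S\<close>: the mistake on the pair, minus 3/2 if the pair is covered and meets
  \<open>S\<close>. Averaging over all pivots reduces the bound to triples; rounding then makes the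
  cluster deterministic.\<close>

lemma exists_pivot_cluster:
  fixes neg cov :: "'a \<Rightarrow> 'a \<Rightarrow> bool"
  assumes "finite V" "V \<noteq> {}"
    and sym: "\<And>v w. neg v w = neg w v" "\<And>v w. cov v w = cov w v"
    and cover: "\<And>u v w. \<lbrakk>u \<in> V; v \<in> V; w \<in> V; u \<noteq> v; v \<noteq> w; u \<noteq> w;
      neg u v; \<not> neg v w; \<not> neg u w\<rbrakk> \<Longrightarrow> cov u v \<or> cov v w \<or> cov u w"
  shows "\<exists>u\<in>V. \<exists>S\<subseteq>V. u \<in> S \<and>
    (\<Sum>v\<in>V. \<Sum>w\<in>V. if v = w then 0
       else balance (neg v w) (cov v w) (of_bool (v \<in> S)) (of_bool (w \<in> S))) \<le> 0"
proof -
  define p where "p u v = (if u = v then 1 else join_prob (neg u v) (cov u v))" for u v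
  define h where "h u v w = (if v = w then 0 else balance (neg v w) (cov v w) (p u v) (p u w))" for u v w
  define f where "f x = (\<Sum>v\<in>V. \<Sum>w\<in>V. if v = w then 0 else balance (neg v w) (cov v w) (x v) (x w))"
    for x :: "'a \<Rightarrow> real"
  have p_sym: "p u v = p v u" for u v
    by (simp add: p_def sym)
  have h_triple: "h u v w + h v w u + h w u v \<le> 0" if "u \<in> V" "v \<in> V" "w \<in> V" for u v w
  proof -
    \<comment> \<open>If two of the three vertices coincide, one of the three terms vanishes, and in
      each other term either the pivot is an end of the pair or the term is zero as well.\<close>
    have pivot: "h a a b \<le> 0" "h a b a \<le> 0" for a b
      using balance_pivot_le_0[of "neg a b" "cov a b"]
      by (auto simp: h_def p_def sym[of b a] balance_commute[of _ _ _ 1])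
    have diag: "h a b b = 0" for a b
      by (simp add: h_def)
    consider "u = v" | "v = w" | "u = w" | "u \<noteq> v" "v \<noteq> w" "u \<noteq> w"
      by blast
    then show ?thesis
    proof cases
      case 4
      then show ?thesis
        using balance_triangle_le_0[of "neg v w" "neg u v" "neg w u" "cov v w" "cov u v" "cov w u"]
          balance_triangle_le_0[of "neg v w" "neg w u" "neg u v" "cov v w" "cov w u" "cov u v"]
          cover[of u v w] cover[of v w u] cover[of w u v] that
        by (simp add: h_def p_def sym[of v u] sym[of w u] sym[of w v] balance_commute) argo
    qed (use pivot[of u v] pivot[of u w] pivot[of v u] pivot[of v w] pivot[of w u] pivot[of w v] diag
        in \<open>auto simp: add_nonpos_nonpos\<close>)
  qed
  have rot1: "(\<Sum>u\<in>V. \<Sum>v\<in>V. \<Sum>w\<in>V. h v w u) = (\<Sum>u\<in>V. \<Sum>v\<in>V. \<Sum>w\<in>V. h u v w)"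
  proof -
    have "(\<Sum>u\<in>V. \<Sum>v\<in>V. \<Sum>w\<in>V. h v w u) = (\<Sum>v\<in>V. \<Sum>u\<in>V. \<Sum>w\<in>V. h v w u)"
      by (rule sum.swap)
    also have "\<dots> = (\<Sum>v\<in>V. \<Sum>w\<in>V. \<Sum>u\<in>V. h v w u)"
      by (rule sum.cong[OF refl sum.swap])
    finally show ?thesis .
  qed
  have rot2: "(\<Sum>u\<in>V. \<Sum>v\<in>V. \<Sum>w\<in>V. h w u v) = (\<Sum>u\<in>V. \<Sum>v\<in>V. \<Sum>w\<in>V. h u v w)"
  proof -
    have "(\<Sum>u\<in>V. \<Sum>v\<in>V. \<Sum>w\<in>V. h w u v) = (\<Sum>u\<in>V. \<Sum>w\<in>V. \<Sum>v\<in>V. h w u v)"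
      by (rule sum.cong[OF refl sum.swap])
    also have "\<dots> = (\<Sum>w\<in>V. \<Sum>u\<in>V. \<Sum>v\<in>V. h w u v)"
      by (rule sum.swap)
    finally show ?thesis .
  qed
  have "(\<Sum>u\<in>V. \<Sum>v\<in>V. \<Sum>w\<in>V. h u v w + h v w u + h w u v) \<le> 0"
    by (intro sum_nonpos h_triple)
  \<comment> \<open>The three rotations have the same total, so the sum over triples is three times
    the sum of \<open>f (p u)\<close> over all pivots. Hence some pivot has nonpositive expected
    balance.\<close>
  then have "(\<Sum>u\<in>V. f (p u)) \<le> 0"
    by (simp add: sum.distrib rot1 rot2 f_def flip: h_def)
  then obtain u where u: "u \<in> V" "f (p u) \<le> 0"
    using sum_pos[of V "\<lambda>u. f (p u)"] assms(1,2) by force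
  \<comment> \<open>The terms with \<open>v = w\<close> are set to 0 in \<open>f\<close>; otherwise
    they would be quadratic in a coordinate.\<close>
  have affine: "f (x(a := t)) = (1 - t) * f (x(a := 0)) + t * f (x(a := 1))" for x a t
  proof -
    have "(if v = w then 0 else balance (neg v w) (cov v w) ((x(a := t)) v) ((x(a := t)) w)) =
      (1 - t) * (if v = w then 0 else balance (neg v w) (cov v w) ((x(a := 0)) v) ((x(a := 0)) w)) +
      t * (if v = w then 0 else balance (neg v w) (cov v w) ((x(a := 1)) v) ((x(a := 1)) w))" for v w
      using balance_affine[of "neg v w" "cov v w" t "x w"] balance_affine[of "neg v w" "cov v w" t "x v"]
      by (auto simp: balance_commute[of _ _ "x v"] algebra_simps)
    then show ?thesis
      unfolding f_def by (simp only: sum.distrib sum_distrib_left)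
  qed
  \<comment> \<open>The coordinate of \<open>u\<close> is left out of the rounding and keeps the
    value 1, so the pivot stays in its cluster.\<close>
  have "\<exists>y. (\<forall>v\<in>V - {u}. y v = 0 \<or> y v = 1) \<and> (\<forall>v. v \<notin> V - {u} \<longrightarrow> y v = p u v) \<and> f y \<le> f (p u)"
    by (rule exists_rounding_le[OF _ affine]) (use assms(1) in \<open>auto simp: p_def join_prob_def\<close>)
  then obtain y where y: "\<forall>v\<in>V - {u}. y v = 0 \<or> y v = 1" "y u = 1" "f y \<le> f (p u)"
    by (auto simp: p_def)
  define S where "S = {v \<in> V. y v = 1}"
  have "y v = of_bool (v \<in> S)" if "v \<in> V" for v
    using y that by (auto simp: S_def)
  then have "f y = f (\<lambda>v. of_bool (v \<in> S))"
    unfolding f_def by (intro sum.cong refl) auto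
  then have "f (\<lambda>v. of_bool (v \<in> S)) \<le> 0"
    using u(2) y(3) by linarith
  moreover have "S \<subseteq> V" "u \<in> S"
    using u(1) y(2) by (auto simp: S_def)
  ultimately show ?thesis
    unfolding f_def using u(1) by blast
qed

text \<open>Iterates the pivot rounds, labelling each vertex by the pivot of its cluster. A pair is
  a mistake exactly when being negative agrees with having equal labels. Keeping the labels inside
  \<open>V\<close> makes those of later rounds differ from the current pivot.\<close>

lemma exists_clustering:
  fixes neg cov :: "'a \<Rightarrow> 'a \<Rightarrow> bool"
  assumes "finite V"
    and sym: "\<And>v w. neg v w = neg w v" "\<And>v w. cov v w = cov w v"
    and "\<And>u v w. \<lbrakk>u \<in> V; v \<in> V; w \<in> V; u \<noteq> v; v \<noteq> w; u \<noteq> w;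
      neg u v; \<not> neg v w; \<not> neg u w\<rbrakk> \<Longrightarrow> cov u v \<or> cov v w \<or> cov u w"
  shows "\<exists>cl :: 'a \<Rightarrow> 'a. cl ` V \<subseteq> V \<and>
    (\<Sum>v\<in>V. \<Sum>w\<in>V. of_bool (v \<noteq> w \<and> neg v w = (cl v = cl w)) - 3/2 * of_bool (v \<noteq> w \<and> cov v w))
      \<le> (0 :: real)"
  using assms(1,4)
proof (induction V rule: finite_psubset_induct)
  case (psubset V)
  show ?case
  proof (cases "V = {}")
    case False
    have "\<exists>u\<in>V. \<exists>S\<subseteq>V. u \<in> S \<and>
      (\<Sum>v\<in>V. \<Sum>w\<in>V. if v = w then 0
         else balance (neg v w) (cov v w) (of_bool (v \<in> S)) (of_bool (w \<in> S))) \<le> 0"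
      by (rule exists_pivot_cluster[OF psubset.hyps False sym]) (fact psubset.prems)
    then obtain u S where S: "u \<in> V" "S \<subseteq> V" "u \<in> S"
      "(\<Sum>v\<in>V. \<Sum>w\<in>V. if v = w then 0
         else balance (neg v w) (cov v w) (of_bool (v \<in> S)) (of_bool (w \<in> S))) \<le> 0"
      by (elim bexE exE conjE) (rule that)
    define d where "d cl v w = of_bool (v \<noteq> w \<and> neg v w = (cl v = cl w))
        - 3/2 * (of_bool (v \<noteq> w \<and> cov v w) :: real)" for cl :: "'a \<Rightarrow> 'a" and v w
    have "V - S \<subset> V"
      using S by auto
    then obtain cl where cl: "cl ` (V - S) \<subseteq> V - S" "(\<Sum>v\<in>V-S. \<Sum>w\<in>V-S. d cl v w) \<le> 0"
    proof -
      have "\<exists>cl. cl ` (V - S) \<subseteq> V - S \<and> (\<Sum>v\<in>V-S. \<Sum>w\<in>V-S. d cl v w) \<le> 0"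
        unfolding d_def
      proof (rule psubset.IH)
        show "cov u v \<or> cov v w \<or> cov u w"
          if "u \<in> V - S" "v \<in> V - S" "w \<in> V - S" "u \<noteq> v" "v \<noteq> w" "u \<noteq> w"
            "neg u v" "\<not> neg v w" "\<not> neg u w" for u v w
          using that by (intro psubset.prems) auto
      qed fact
      then show ?thesis
        using that by blast
    qed
    define cl' where "cl' v = (if v \<in> S then u else cl v)" for v
    have clu: "cl v \<noteq> u" if "v \<in> V" "v \<notin> S" for v
      using cl(1) S that by blast
    \<comment> \<open>Pairs inside \<open>V - S\<close> are left to the recursion, and their
      \<open>balance\<close> is 0. All other pairs are settled now: since no label outside
      \<open>S\<close> equals \<open>u\<close>, their contribution is exactly their
      \<open>balance\<close>.\<close>
    have "d cl' v w = (if v \<in> V - S then if w \<in> V - S then d cl v w else 0 else 0)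
      + (if v = w then 0 else balance (neg v w) (cov v w) (of_bool (v \<in> S)) (of_bool (w \<in> S)))"
      if "v \<in> V" "w \<in> V" for v w
      using clu[of v] clu[of w] that
      by (cases "v \<in> S"; cases "w \<in> S") (auto simp: d_def cl'_def balance_def)
    then have "(\<Sum>v\<in>V. \<Sum>w\<in>V. d cl' v w) =
        (\<Sum>v\<in>V. \<Sum>w\<in>V. if v \<in> V - S then if w \<in> V - S then d cl v w else 0 else 0)
      + (\<Sum>v\<in>V. \<Sum>w\<in>V. if v = w then 0
           else balance (neg v w) (cov v w) (of_bool (v \<in> S)) (of_bool (w \<in> S)))"
      by (simp add: sum.distrib cong: sum.cong)
    also have "(\<Sum>v\<in>V. \<Sum>w\<in>V. if v \<in> V - S then if w \<in> V - S then d cl v w else 0 else 0) =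
        (\<Sum>v\<in>V-S. \<Sum>w\<in>V-S. d cl v w)"
    proof -
      have restrict: "(\<Sum>v\<in>V-S. g v) = (\<Sum>v\<in>V. if v \<in> V - S then g v else 0)" for g :: "'a \<Rightarrow> real"
        using sum.inter_restrict[OF psubset.hyps, of g "V - S"] by (simp add: Int_absorb1)
      show ?thesis
        unfolding restrict by (intro sum.cong refl) auto
    qed
    finally have "(\<Sum>v\<in>V. \<Sum>w\<in>V. d cl' v w) \<le> 0"
      using cl(2) S(4) by linarith
    moreover have "cl' ` V \<subseteq> V"
      using cl(1) S by (auto simp: cl'_def)
    ultimately show ?thesis
      unfolding d_def by blast
  qed simp
qed

section \<open>From double sums to edge counts\<close>

lemma sum_of_bool_pairs:
  assumes "finite V" "E \<subseteq> pairs V"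
  shows "(\<Sum>v\<in>V. \<Sum>w\<in>V. of_bool ({v, w} \<in> E)) = 2 * real (card E)"
proof -
  let ?D = "{z \<in> V \<times> V. {fst z, snd z} \<in> E}"
  have fin: "finite E"
    using assms by (auto simp: pairs_def intro: finite_subset[of _ "Pow V"])
  \<comment> \<open>Every pair arises from its two orderings; this is the source of the factor
    2.\<close>
  have fibre: "card {z \<in> ?D. {fst z, snd z} = e} = 2" if "e \<in> E" for e
  proof -
    from that assms obtain a b where ab: "e = {a, b}" "a \<noteq> b" "a \<in> V" "b \<in> V"
      by (auto simp: pairs_def card_2_iff)
    then have "{z \<in> ?D. {fst z, snd z} = e} = {(a, b), (b, a)}"
      using that by (auto simp: doubleton_eq_iff insert_commute)
    then show ?thesis
      using ab by simp
  qed
  have "(\<Sum>v\<in>V. \<Sum>w\<in>V. of_bool ({v, w} \<in> E)) = (\<Sum>z\<in>V \<times> V. of_bool ({fst z, snd z} \<in> E) :: real)"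
    by (simp add: sum.cartesian_product case_prod_unfold)
  also have "\<dots> = real (card ?D)"
    using assms(1) by (simp add: sum.inter_filter[symmetric] of_bool_def)
  also have "card ?D = (\<Sum>e\<in>E. card {z \<in> ?D. {fst z, snd z} = e})"
    using sum.group[of ?D E "\<lambda>z. {fst z, snd z}" "\<lambda>_. 1 :: nat"] assms(1) fin
    by (simp add: image_subset_iff)
  also have "\<dots> = 2 * card E"
    using fibre by simp
  finally show ?thesis by simp
qed

text \<open>Turns the set-based cover condition into the condition on ordered triples required by
  the clustering argument.\<close>

lemma bad_triangle_coverD:
  assumes cover: "bad_triangle_cover V Ep En C"
    and V: "u \<in> V" "v \<in> V" "w \<in> V" and neq: "u \<noteq> v" "v \<noteq> w" "u \<noteq> w"
    and sign: "{u, v} \<in> En" "{v, w} \<notin> En" "{u, w} \<notin> En"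
  shows "{u, v} \<in> C \<or> {v, w} \<in> C \<or> {u, w} \<in> C"
proof -
  have sub: "e \<in> {{u, v}, {v, w}, {u, w}}" if "e \<in> pairs {u, v, w}" for e
    using that by (auto simp: pairs_def card_2_iff)
  have "{u, v} \<in> pairs {u, v, w}"
    using neq by (simp add: pairs_def)
  then have "pairs {u, v, w} \<inter> En = {{u, v}}"
    using sub sign by blast
  then have "bad_triangle V Ep En {u, v, w}"
    using V neq by (simp add: bad_triangle_def)
  then have "pairs {u, v, w} \<inter> C \<noteq> {}"
    using cover by (simp add: bad_triangle_cover_def)
  then show ?thesis
    using sub by blast
qed

lemma partition_on_fibres: "partition_on V ((\<lambda>v. {w \<in> V. cl w = cl v}) ` V)"
proof (rule partition_onI)
  fix A B assume "A \<in> (\<lambda>v. {w \<in> V. cl w = cl v}) ` V" "B \<in> (\<lambda>v. {w \<in> V. cl w = cl v}) ` V"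
    and neq: "A \<noteq> B"
  then obtain a b where ab: "A = {w \<in> V. cl w = cl a}" "B = {w \<in> V. cl w = cl b}"
    by blast
  with neq have "cl a \<noteq> cl b"
    by metis
  with ab show "disjnt A B"
    by (simp add: disjnt_iff)
next
  have "v \<in> {w \<in> V. cl w = cl v}" if "v \<in> V" for v
    using that by simp
  then show "{} \<notin> (\<lambda>v. {w \<in> V. cl w = cl v}) ` V"
    by blast
qed blast

text \<open>The two kinds of mistakes are disjoint sets of pairs, so they can be counted together as
  one set, each pair in both orderings.\<close>

lemma disagreements_fibres:
  assumes G: "complete_signed_graph V Ep En"
  shows "2 * real (disagreements Ep En ((\<lambda>v. {w \<in> V. cl w = cl v}) ` V)) =
    (\<Sum>v\<in>V. \<Sum>w\<in>V. of_bool (v \<noteq> w \<and> ({v, w} \<in> En) = (cl v = cl w)))"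
proof -
  let ?P = "(\<lambda>v. {w \<in> V. cl w = cl v}) ` V"
  define X where "X = {e \<in> Ep. \<exists>A\<in>?P. \<exists>B\<in>?P. A \<noteq> B \<and> e \<inter> A \<noteq> {} \<and> e \<inter> B \<noteq> {}}"
  define Y where "Y = {e \<in> En. \<exists>A\<in>?P. e \<subseteq> A}"
  have V: "finite V" and pairs: "Ep \<union> En = pairs V" and disj: "Ep \<inter> En = {}"
    using G by (auto simp: complete_signed_graph_def)
  have fin: "finite (Ep \<union> En)"
    unfolding pairs using V by (auto simp: pairs_def)
  define K where "K v = {w \<in> V. cl w = cl v}" for v
  have K_iff: "w \<in> K v \<longleftrightarrow> w \<in> V \<and> cl w = cl v" for v w
    by (simp add: K_def)
  have K_eqI: "K v = K w" if "cl v = cl w" for v w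
    using that by (simp add: K_def)
  have split: "(\<exists>A\<in>?P. \<exists>B\<in>?P. A \<noteq> B \<and> {v, w} \<inter> A \<noteq> {} \<and> {v, w} \<inter> B \<noteq> {}) \<longleftrightarrow> cl v \<noteq> cl w"
    if "v \<in> V" "w \<in> V" for v w
    unfolding K_def[symmetric]
  proof
    assume neq: "cl v \<noteq> cl w"
    have "v \<in> K v" "w \<in> K w" "v \<notin> K w"
      using that neq by (simp_all add: K_iff)
    then show "\<exists>A\<in>K ` V. \<exists>B\<in>K ` V. A \<noteq> B \<and> {v, w} \<inter> A \<noteq> {} \<and> {v, w} \<inter> B \<noteq> {}"
      using that by blast
  next
    assume "\<exists>A\<in>K ` V. \<exists>B\<in>K ` V. A \<noteq> B \<and> {v, w} \<inter> A \<noteq> {} \<and> {v, w} \<inter> B \<noteq> {}"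
    then obtain a b x y where "K a \<noteq> K b" "x \<in> K a" "y \<in> K b" "x \<in> {v, w}" "y \<in> {v, w}"
      by blast
    \<comment> \<open>If the labels of \<open>v\<close> and \<open>w\<close> agreed, then
      \<open>x\<close> and \<open>y\<close> would give \<open>cl a = cl b\<close>, making the two
      classes equal.\<close>
    then show "cl v \<noteq> cl w"
      using K_eqI[of a b] by (auto simp: K_iff)
  qed
  have inside: "(\<exists>A\<in>?P. {v, w} \<subseteq> A) \<longleftrightarrow> cl v = cl w" if "v \<in> V" "w \<in> V" for v w
    unfolding K_def[symmetric] using that by (auto simp: K_iff)
  \<comment> \<open>For \<open>v = w\<close> the set is a singleton, hence neither a positive nor a
    negative edge; for distinct vertices exactly one sign applies, which yields the single
    equivalence.\<close>
  have mem: "{v, w} \<in> X \<union> Y \<longleftrightarrow> v \<noteq> w \<and> ({v, w} \<in> En) = (cl v = cl w)"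
    if "v \<in> V" "w \<in> V" for v w
  proof -
    have "{v, w} \<in> Ep \<union> En \<longleftrightarrow> v \<noteq> w"
      unfolding pairs using that by (auto simp: pairs_def card_2_iff)
    moreover have "{v, w} \<in> X \<union> Y \<longleftrightarrow>
        {v, w} \<in> Ep \<and> cl v \<noteq> cl w \<or> {v, w} \<in> En \<and> cl v = cl w"
      by (simp only: X_def Y_def Un_iff mem_Collect_eq split[OF that] inside[OF that])
    moreover have "\<not> ({v, w} \<in> Ep \<and> {v, w} \<in> En)"
      using disj by blast
    ultimately show ?thesis
      unfolding Un_iff by argo
  qed
  have XY: "X \<subseteq> Ep" "Y \<subseteq> En"
    by (simp_all add: X_def Y_def)
  have "disagreements Ep En ?P = card X + card Y"
    by (simp only: disagreements_def X_def Y_def)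
  also have "\<dots> = card (X \<union> Y)"
    using XY fin disj by (intro card_Un_disjoint[symmetric]) (auto intro: finite_subset)
  finally have "disagreements Ep En ?P = card (X \<union> Y)" .
  moreover have "X \<union> Y \<subseteq> pairs V"
    using pairs XY by blast
  ultimately have "2 * real (disagreements Ep En ?P) = (\<Sum>v\<in>V. \<Sum>w\<in>V. of_bool ({v, w} \<in> X \<union> Y))"
    using sum_of_bool_pairs[OF V, of "X \<union> Y"] by simp
  also have "\<dots> = (\<Sum>v\<in>V. \<Sum>w\<in>V. of_bool (v \<noteq> w \<and> ({v, w} \<in> En) = (cl v = cl w)))"
    by (intro sum.cong refl) (simp only: mem)
  finally show ?thesis .
qed

theorem theorem3:
  fixes V :: "'a set" and Ep En :: "'a set set"
  assumes "complete_signed_graph V Ep En"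
  shows "real (OPT_CC V Ep En) \<le> 3 / 2 * real (OPT_Delta V Ep En)"
proof -
  have V: "finite V"
    using assms by (simp add: complete_signed_graph_def)
  obtain C where C: "bad_triangle_cover V Ep En C" "OPT_Delta V Ep En = card C"
    using Min_in[OF OPT_Delta_set[OF assms]] by (auto simp: OPT_Delta_def)
  have sub: "C \<subseteq> pairs V"
    using C(1) by (simp add: bad_triangle_cover_def)
  obtain cl :: "'a \<Rightarrow> 'a" where cl:
    "(\<Sum>v\<in>V. \<Sum>w\<in>V. of_bool (v \<noteq> w \<and> ({v, w} \<in> En) = (cl v = cl w))
       - 3/2 * of_bool (v \<noteq> w \<and> {v, w} \<in> C)) \<le> (0 :: real)"
    using exists_clustering[of V "\<lambda>v w. {v, w} \<in> En" "\<lambda>v w. {v, w} \<in> C"]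
      V bad_triangle_coverD[OF C(1)] by (auto simp: insert_commute)
  let ?P = "(\<lambda>v. {w \<in> V. cl w = cl v}) ` V"
  have "(v \<noteq> w \<and> {v, w} \<in> C) \<longleftrightarrow> {v, w} \<in> C" for v w
    using sub by (auto simp: pairs_def)
  \<comment> \<open>Mistakes and covered pairs are both counted twice by the double sums, so the
    ratio 3/2 carries over to their cardinalities.\<close>
  then have "2 * real (disagreements Ep En ?P) - 3/2 * (2 * real (card C)) \<le> 0"
    using cl unfolding disagreements_fibres[OF assms] sum_of_bool_pairs[OF V sub, symmetric]
    by (simp add: sum_subtractf sum_distrib_left)
  moreover have "OPT_CC V Ep En \<le> disagreements Ep En ?P"
    unfolding OPT_CC_def
    by (rule Min_le[OF OPT_CC_set(1)[OF assms]]) (use partition_on_fibres in blast)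
  ultimately show ?thesis
    using C(2) by simp
qed

end
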